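(* Let $G=(V,E)$ be a finite graph, let $A,B,C\subseteq E$ be chosen independently and uniformly at random and let $\Delta$ be the event that $A\bigtriangleup B$ and $B\bigtriangleup C$ are both eulerian. If $|E|\not\equiv 1\pmod 4$, then the event that $|A|+|B|+|C|\equiv 0$ or $1\pmod 4$ (i.e. that $\left\lfloor\frac{|A|+|B|+|C|}{2}\right\rfloor$ is even) is correlated with $\Delta$ as follows: $$\frac{\mathrm{Bias}(|A|+|B|+|C|\equiv 0,1\ (\mathrm{mod}\ 4)\mid\Delta)}{\mathrm{Bias}(|A|+|B|+|C|\equiv 0,1\ (\mathrm{mod}\ 4))}=2^{r(G)}(-1)^{n(G)}\,T(G;-1,-1).$$ If $|E|\equiv 1\pmod 4$, then $$\mathrm{Bias}(|A|+|B|+|C|\equiv 0,1\ (\mathrm{mod}\ 4))=0=\mathrm{Bias}(|A|+|B|+|C|\equiv 0,1\ (\mathrm{mod}\ 4)\mid\Delta).$$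
   Context: Graphs are finite; loops and parallel edges are permitted. A subset $A\subseteq E$ is identified with the subgraph $(V,A)$ of $G$; it is called eulerian if all its vertex degrees are even (a loop contributes 2 to the degree). $\bigtriangleup$ is symmetric difference of sets. For $A\subseteq E$, $r(A)=|V|-k(A)$, where $k(A)$ is the number of connected components of $(V,A)$; $r(G)=r(E)$ and $n(G)=|E|-r(G)$. The Tutte polynomial is $T(G;x,y)=\sum_{A\subseteq E}(x-1)^{r(E)-r(A)}(y-1)^{|A|-r(A)}$. For an event $\Sigma$, $\mathrm{Bias}(\Sigma)=\mathbb{P}(\Sigma)-\mathbb{P}(\overline{\Sigma})$ and $\mathrm{Bias}(\Sigma\mid\Delta)=\mathbb{P}(\Sigma\mid\Delta)-\mathbb{P}(\overline{\Sigma}\mid\Delta)$, where $\overline{\Sigma}$ is the complement of $\Sigma$. *)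

theory Defs
  imports "HOL-Probability.Probability"
begin

(* Multigraphs: edges are abstract, so parallel edges are allowed.  An edge is incident to
   the set of its endpoints, which is a singleton exactly when the edge is a loop. *)
record ('v, 'e) multigraph =
  verts :: "'v set"
  edges :: "'e set"
  ends :: "'e \<Rightarrow> 'v set"

locale finite_multigraph =
  fixes G :: "('v, 'e) multigraph"
  assumes finite_verts: "finite (verts G)"
    and finite_edges: "finite (edges G)"
    and ends_subset: "e \<in> edges G \<Longrightarrow> ends G e \<subseteq> verts G"
    and card_ends: "e \<in> edges G \<Longrightarrow> card (ends G e) = 1 \<or> card (ends G e) = 2"

(* Edge sets A are identified with the spanning subgraph (verts G, A).  Loops are counted by
   both summands and hence contribute 2. *)
definition degree :: "('v, 'e) multigraph \<Rightarrow> 'e set \<Rightarrow> 'v \<Rightarrow> nat" where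
  "degree G A v = card {e \<in> A. v \<in> ends G e} + card {e \<in> A. ends G e = {v}}"

definition eulerian :: "('v, 'e) multigraph \<Rightarrow> 'e set \<Rightarrow> bool" where
  "eulerian G A \<longleftrightarrow> (\<forall>v\<in>verts G. even (degree G A v))"

definition adj_rel :: "('v, 'e) multigraph \<Rightarrow> 'e set \<Rightarrow> 'v rel" where
  "adj_rel G A = {(u, v). \<exists>e\<in>A. ends G e = {u, v}}"

definition connected_rel :: "('v, 'e) multigraph \<Rightarrow> 'e set \<Rightarrow> 'v rel" where
  "connected_rel G A = {(u, v). u \<in> verts G \<and> v \<in> verts G \<and> (u, v) \<in> (adj_rel G A)\<^sup>*}"

definition num_components :: "('v, 'e) multigraph \<Rightarrow> 'e set \<Rightarrow> nat" where
  "num_components G A = card (verts G // connected_rel G A)"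

(* For finite multigraphs none of the natural number subtractions below truncates: the number
   of components is at most the number of vertices, and the rank is monotone in the edge set
   and bounded by its cardinality. *)
definition graph_rank :: "('v, 'e) multigraph \<Rightarrow> 'e set \<Rightarrow> nat" where
  "graph_rank G A = card (verts G) - num_components G A"

definition graph_nullity :: "('v, 'e) multigraph \<Rightarrow> nat" where
  "graph_nullity G = card (edges G) - graph_rank G (edges G)"

definition tutte :: "('v, 'e) multigraph \<Rightarrow> real \<Rightarrow> real \<Rightarrow> real" where
  "tutte G x y =
     (\<Sum>A\<in>Pow (edges G). (x - 1) ^ (graph_rank G (edges G) - graph_rank G A)
                        * (y - 1) ^ (card A - graph_rank G A))"

definition bias :: "'a measure \<Rightarrow> ('a \<Rightarrow> bool) \<Rightarrow> real" where
  "bias M P = \<P>(\<omega> in M. P \<omega>) - \<P>(\<omega> in M. \<not> P \<omega>)"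

definition cond_bias :: "'a measure \<Rightarrow> ('a \<Rightarrow> bool) \<Rightarrow> ('a \<Rightarrow> bool) \<Rightarrow> real" where
  "cond_bias M P Q = \<P>(\<omega> in M. P \<omega> \<bar> Q \<omega>) - \<P>(\<omega> in M. \<not> P \<omega> \<bar> Q \<omega>)"

definition random_triple :: "('v, 'e) multigraph \<Rightarrow> ('e set \<times> 'e set \<times> 'e set) pmf" where
  "random_triple G =
     (let U = pmf_of_set (Pow (edges G)) in pair_pmf U (pair_pmf U U))"

definition size_event :: "'e set \<times> 'e set \<times> 'e set \<Rightarrow> bool" where
  "size_event = (\<lambda>(A, B, C). (card A + card B + card C) mod 4 \<in> {0, 1})"

(* This event has positive probability, as it holds whenever A = B = C. *)
definition eulerian_diffs :: "('v, 'e) multigraph \<Rightarrow> 'e set \<times> 'e set \<times> 'e set \<Rightarrow> bool" where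
  "eulerian_diffs G = (\<lambda>(A, B, C). eulerian G (sym_diff A B) \<and> eulerian G (sym_diff B C))"

end

theory Submission
  imports Defs
begin

text \<open>The sign of the event \<open>n mod 4 \<in> {0, 1}\<close> is the real part of \<open>(1 - \<i>) * \<i> ^ n\<close>, so both biases
  are sums of powers of \<open>\<i>\<close>, which factor over the edges. Writing \<open>m\<close> for the number of edges, the sum
  over all triples is \<open>(1 + \<i>) ^ (3 * m) = (-2) ^ m * (1 - \<i>) ^ m\<close>. With \<open>X\<close> and \<open>Y\<close> the symmetric
  differences of \<open>A, B\<close> and \<open>B, C\<close> held fixed, summing over \<open>B\<close> gives
  \<open>(1 - \<i>) ^ m * (-1) ^ card (X \<union> Y)\<close>. The common factor cancels in the ratio, and the remaining sum
  of \<open>(-1) ^ card (X \<union> Y)\<close> over pairs of eulerian sets is, up to a simple factor, \<open>T(-1, -1)\<close>.\<close>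

section \<open>Unions of equivalence classes, and sums over subsets as products\<close>

text \<open>A closed set is the union of the classes of its points. Together with injectivity of
  \<open>\<Union>\<close> on sets of classes, this counts closed sets as 2 to the number of
  classes.\<close>

lemma Union_image_Pow_quotient:
  assumes "equiv V R"
  shows "\<Union> ` Pow (V // R) = {S. S \<subseteq> V \<and> R `` S \<subseteq> S}"
proof (intro equalityI subsetI)
  fix S assume "S \<in> \<Union> ` Pow (V // R)"
  then obtain X where X: "X \<subseteq> V // R" "S = \<Union>X" by auto
  have "S \<subseteq> V" using X Union_quotient[OF assms] by blast
  moreover have "R `` S \<subseteq> S"
    using X in_quotient_imp_closed[OF assms] by blast
  ultimately show "S \<in> {S. S \<subseteq> V \<and> R `` S \<subseteq> S}" by simp
next
  fix S assume "S \<in> {S. S \<subseteq> V \<and> R `` S \<subseteq> S}"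
  then have S: "S \<subseteq> V" "R `` S \<subseteq> S" by auto
  have "S = \<Union>((\<lambda>x. R `` {x}) ` S)"
    using S equiv_class_self[OF assms] by blast
  moreover have "(\<lambda>x. R `` {x}) ` S \<subseteq> V // R"
    using S by (auto intro: quotientI)
  ultimately show "S \<in> \<Union> ` Pow (V // R)" by blast
qed

text \<open>Classes are nonempty and pairwise disjoint, so any point of a class in \<open>X\<close>
  forces the same class to lie in \<open>Y\<close>.\<close>

lemma inj_on_Union_Pow_quotient:
  assumes "equiv V R"
  shows "inj_on \<Union> (Pow (V // R))"
proof -
  have "X \<subseteq> Y" if XY: "X \<subseteq> V // R" "Y \<subseteq> V // R" "\<Union>X = \<Union>Y" for X Y
  proof
    fix K assume K: "K \<in> X"
    with XY obtain x where x: "x \<in> K" using in_quotient_imp_non_empty[OF assms] by blast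
    with K XY obtain L where L: "L \<in> Y" "x \<in> L" by blast
    have "K = L" using quotient_disj[OF assms, of K L] K L x XY by blast
    with L show "K \<in> Y" by simp
  qed
  then show ?thesis by (intro inj_onI) (simp add: subset_antisym)
qed

lemma sum_Pow_prod:
  fixes f :: "'a \<Rightarrow> 'b::comm_semiring_1"
  assumes "finite A"
  shows "(\<Sum>X\<in>Pow A. \<Prod>x\<in>X. f x) = (\<Prod>x\<in>A. f x + 1)"
  by (simp add: prod_add[OF assms])

text \<open>Each factor is 2 or 0. Applied after \<open>sum_Pow_prod\<close>, this is orthogonality
  of characters: a sum of signs over all subsets vanishes unless every sign is 1.\<close>

lemma prod_plus_one_of_signs:
  fixes f :: "'a \<Rightarrow> real"
  assumes "finite A" and "\<And>x. x \<in> A \<Longrightarrow> f x = 1 \<or> f x = -1"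
  shows "(\<Prod>x\<in>A. f x + 1) = (if \<forall>x\<in>A. f x = 1 then 2 ^ card A else 0)"
proof (cases "\<forall>x\<in>A. f x = 1")
  case False
  then obtain x where "x \<in> A" "f x + 1 = 0" using assms(2) by force
  then show ?thesis using assms(1) False by (auto intro: prod_zero)
qed simp

section \<open>Counting eulerian sets through components and rank\<close>

definition eulerian_subsets :: "('v, 'e) multigraph \<Rightarrow> 'e set \<Rightarrow> 'e set set" where
  "eulerian_subsets G A = {X. X \<subseteq> A \<and> eulerian G X}"

text \<open>The vertex sets whose cut in \<open>A\<close> is empty, phrased edge by edge to match
  the sign that a single edge contributes in the double count.\<close>

definition unsplit_sets :: "('v, 'e) multigraph \<Rightarrow> 'e set \<Rightarrow> 'v set set" where
  "unsplit_sets G A =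
     {S. S \<subseteq> verts G \<and> (\<forall>e\<in>A. ends G e \<subseteq> S \<or> ends G e \<inter> S = {})}"

context finite_multigraph
begin

lemma finite_edge_subset: "A \<subseteq> edges G \<Longrightarrow> finite A"
  using finite_edges finite_subset by blast

lemma ends_cases:
  assumes "e \<in> edges G"
  obtains u v where "ends G e = {u, v}" "u \<in> verts G" "v \<in> verts G"
proof -
  have "\<exists>u v. ends G e = {u, v}"
    using card_ends[OF assms] by (auto simp: card_1_singleton_iff card_2_iff)
  then show ?thesis using ends_subset[OF assms] that by auto
qed

lemma equiv_connected_rel: "equiv (verts G) (connected_rel G A)"
proof (rule equivI)
  have "sym (adj_rel G A)" by (auto simp: sym_def adj_rel_def insert_commute)
  then have "sym ((adj_rel G A)\<^sup>*)" by (rule sym_rtrancl)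
  then show "sym (connected_rel G A)" by (auto simp: sym_def connected_rel_def)
qed (auto simp: connected_rel_def refl_on_def trans_def)

text \<open>A walk starting in an unsplit set never leaves it, by induction along the walk.
  Conversely, the ends of an edge are related in both directions, so a closed set contains both or
  neither.\<close>

lemma unsplit_sets_eq_closed:
  assumes A: "A \<subseteq> edges G"
  shows "unsplit_sets G A = {S. S \<subseteq> verts G \<and> connected_rel G A `` S \<subseteq> S}"
proof (intro equalityI subsetI)
  fix S assume S: "S \<in> unsplit_sets G A"
  have "v \<in> S" if "(u, v) \<in> (adj_rel G A)\<^sup>*" "u \<in> S" for u v
    using that
  proof induction
    case (step v w)
    then show ?case using S by (auto simp: adj_rel_def unsplit_sets_def)
  qed
  then show "S \<in> {S. S \<subseteq> verts G \<and> connected_rel G A `` S \<subseteq> S}"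
    using S by (auto simp: unsplit_sets_def connected_rel_def)
next
  fix S assume "S \<in> {S. S \<subseteq> verts G \<and> connected_rel G A `` S \<subseteq> S}"
  then have S: "S \<subseteq> verts G" "connected_rel G A `` S \<subseteq> S" by auto
  have "ends G e \<subseteq> S \<or> ends G e \<inter> S = {}" if e: "e \<in> A" for e
  proof -
    obtain u v where uv: "ends G e = {u, v}" "u \<in> verts G" "v \<in> verts G"
      using ends_cases e A by blast
    then have "(u, v) \<in> adj_rel G A" "(v, u) \<in> adj_rel G A"
      using e by (auto simp: adj_rel_def)
    then have "(u, v) \<in> connected_rel G A" "(v, u) \<in> connected_rel G A"
      using uv by (auto simp: connected_rel_def)
    then show ?thesis using S uv by auto
  qed
  then show "S \<in> unsplit_sets G A" using S by (simp add: unsplit_sets_def)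
qed

lemma finite_components: "finite (verts G // connected_rel G A)"
  by (simp add: finite_verts quotient_def)

lemma card_unsplit_sets:
  assumes "A \<subseteq> edges G"
  shows "card (unsplit_sets G A) = 2 ^ num_components G A"
  using card_image[OF inj_on_Union_Pow_quotient[OF equiv_connected_rel[of A]]]
  by (simp add: unsplit_sets_eq_closed[OF assms] Union_image_Pow_quotient[OF equiv_connected_rel]
      card_Pow[OF finite_components] num_components_def)

lemma num_components_le: "num_components G A \<le> card (verts G)"
proof -
  have "verts G // connected_rel G A = (\<lambda>x. connected_rel G A `` {x}) ` verts G"
    by (auto simp: quotient_def)
  then show ?thesis unfolding num_components_def by (simp add: card_image_le finite_verts)
qed

lemma finite_unsplit_sets: "finite (unsplit_sets G A)"
  by (rule finite_subset[of _ "Pow (verts G)"]) (auto simp: unsplit_sets_def finite_verts)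

lemma finite_eulerian_subsets: "A \<subseteq> edges G \<Longrightarrow> finite (eulerian_subsets G A)"
  by (rule finite_subset[of _ "Pow A"]) (auto simp: eulerian_subsets_def finite_edge_subset)

text \<open>More edges impose more constraints on unsplit sets, and the number of these determines
  the number of components.\<close>

lemma num_components_antimono:
  assumes "A \<subseteq> B" "B \<subseteq> edges G"
  shows "num_components G B \<le> num_components G A"
proof -
  have "unsplit_sets G B \<subseteq> unsplit_sets G A" using assms by (auto simp: unsplit_sets_def)
  then have "card (unsplit_sets G B) \<le> card (unsplit_sets G A)"
    by (intro card_mono finite_unsplit_sets)
  then show ?thesis using assms by (simp add: card_unsplit_sets)
qed

lemma degree_eq_sum:
  assumes "X \<subseteq> edges G"
  shows "degree G X v = (\<Sum>e\<in>X. of_bool (v \<in> ends G e) + of_bool (ends G e = {v}))"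
  using finite_edge_subset[OF assms]
  by (simp add: degree_def sum.distrib of_bool_def sum.If_cases Int_def)

text \<open>The exponents add up to the number of ends of \<open>e\<close> in \<open>S\<close>, a
  loop counting 0 or 2. This is odd exactly when one of two distinct ends lies in
  \<open>S\<close>.\<close>

lemma edge_sign:
  assumes "e \<in> edges G" "S \<subseteq> verts G"
  shows "(\<Prod>v\<in>S. (-1::real) ^ (of_bool (v \<in> ends G e) + of_bool (ends G e = {v})))
       = (if ends G e \<subseteq> S \<or> ends G e \<inter> S = {} then 1 else -1)"
proof -
  obtain u v where uv: "ends G e = {u, v}" using ends_cases assms(1) by blast
  have "finite S" using assms(2) finite_verts finite_subset by blast
  let ?f = "\<lambda>w. (-1::real) ^ (of_bool (w \<in> ends G e) + of_bool (ends G e = {w}))"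
  have "(\<Prod>w\<in>S. ?f w) = (\<Prod>w\<in>S \<inter> {u, v}. ?f w)"
    using uv \<open>finite S\<close> by (intro prod.mono_neutral_right) auto
  also have "\<dots> = (if ends G e \<subseteq> S \<or> ends G e \<inter> S = {} then 1 else -1)"
    using uv by (cases "u = v"; cases "u \<in> S"; cases "v \<in> S") (auto simp: doubleton_eq_iff)
  finally show ?thesis .
qed

text \<open>Double counting of the signed pairs \<open>(X, S)\<close>, with sign \<open>(-1)\<close> to the power of the degree sum
  of \<open>X\<close> over \<open>S\<close>: summing over \<open>S\<close> first leaves the eulerian \<open>X\<close>, summing over \<open>X\<close> first leaves
  the sets \<open>S\<close> that are unions of components.\<close>

lemma card_eulerian_subsets_times:
  assumes A: "A \<subseteq> edges G"
  shows "card (eulerian_subsets G A) * 2 ^ card (verts G) = 2 ^ card A * 2 ^ num_components G A"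
proof -
  note fA = finite_edge_subset[OF A]
  define \<epsilon> where "\<epsilon> X S = (\<Prod>v\<in>S. (-1::real) ^ degree G X v)" for X S
  \<comment> \<open>For fixed \<open>X\<close> the sum is the product over the vertices of
    \<open>(-1) ^ degree G X v + 1\<close>, which vanishes at any vertex of odd degree.\<close>
  have "(\<Sum>S\<in>Pow (verts G). \<epsilon> X S) = (if eulerian G X then 2 ^ card (verts G) else 0)" for X
    unfolding \<epsilon>_def sum_Pow_prod[OF finite_verts]
    by (subst prod_plus_one_of_signs) (auto simp: finite_verts eulerian_def minus_one_power_iff)
  then have "(\<Sum>X\<in>Pow A. \<Sum>S\<in>Pow (verts G). \<epsilon> X S)
      = real (card (eulerian_subsets G A) * 2 ^ card (verts G))"
    using fA by (simp add: sum.If_cases eulerian_subsets_def Int_def Pow_def)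
  moreover have "(\<Sum>X\<in>Pow A. \<epsilon> X S) = (if S \<in> unsplit_sets G A then 2 ^ card A else 0)"
    if S: "S \<in> Pow (verts G)" for S
  proof -
    \<comment> \<open>For fixed \<open>S\<close>, degrees are additive over the edges of
      \<open>X\<close>, so the sign factors into one sign \<open>w e\<close> per edge.\<close>
    define w where
      "w e = (\<Prod>v\<in>S. (-1::real) ^ (of_bool (v \<in> ends G e) + of_bool (ends G e = {v})))" for e
    have "\<epsilon> X S = (\<Prod>e\<in>X. w e)" if "X \<in> Pow A" for X
    proof -
      have "X \<subseteq> edges G" using that A by blast
      then have "\<epsilon> X S
          = (\<Prod>v\<in>S. \<Prod>e\<in>X. (-1) ^ (of_bool (v \<in> ends G e) + of_bool (ends G e = {v})))"
        by (simp add: \<epsilon>_def degree_eq_sum power_sum)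
      also have "\<dots> = (\<Prod>e\<in>X. w e)" unfolding w_def by (rule prod.swap)
      finally show ?thesis .
    qed
    then have "(\<Sum>X\<in>Pow A. \<epsilon> X S) = (\<Prod>e\<in>A. w e + 1)"
      by (simp add: sum_Pow_prod[OF fA, symmetric])
    moreover have "w e = (if ends G e \<subseteq> S \<or> ends G e \<inter> S = {} then 1 else -1)" if "e \<in> A" for e
      unfolding w_def using that A S by (intro edge_sign) auto
    ultimately show ?thesis
      using S fA by (subst (asm) prod_plus_one_of_signs) (auto simp: unsplit_sets_def)
  qed
  then have "(\<Sum>S\<in>Pow (verts G). \<Sum>X\<in>Pow A. \<epsilon> X S)
      = real (2 ^ card A * card (Pow (verts G) \<inter> unsplit_sets G A))"
    by (simp add: sum.If_cases finite_verts)
  moreover have "Pow (verts G) \<inter> unsplit_sets G A = unsplit_sets G A"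
    by (auto simp: unsplit_sets_def)
  ultimately have "real (card (eulerian_subsets G A) * 2 ^ card (verts G))
      = real (2 ^ card A * 2 ^ num_components G A)"
    using sum.swap[of \<epsilon> "Pow (verts G)" "Pow A"] card_unsplit_sets[OF A] by simp
  then show ?thesis by (simp only: of_nat_eq_iff)
qed

text \<open>Cancels \<open>2 ^ num_components G A\<close> in the double count. The form is
  multiplicative because the bound on the rank that justifies subtracting exponents is itself
  deduced from it.\<close>

lemma card_eulerian_subsets_rank:
  assumes A: "A \<subseteq> edges G"
  shows "card (eulerian_subsets G A) * 2 ^ graph_rank G A = 2 ^ card A"
proof -
  have "2 ^ card (verts G) = (2::nat) ^ graph_rank G A * 2 ^ num_components G A"
    using num_components_le[of A] by (simp add: graph_rank_def flip: power_add)
  then show ?thesis using card_eulerian_subsets_times[OF A] by (simp add: ac_simps)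
qed

lemma empty_in_eulerian_subsets: "{} \<in> eulerian_subsets G A"
  by (simp add: eulerian_subsets_def eulerian_def degree_def)

text \<open>The empty set is eulerian, so the cofactor of \<open>2 ^ graph_rank G A\<close> in
  \<open>2 ^ card A\<close> is at least 1.\<close>

lemma rank_le_card:
  assumes A: "A \<subseteq> edges G"
  shows "graph_rank G A \<le> card A"
proof -
  have "card (eulerian_subsets G A) > 0"
    using empty_in_eulerian_subsets finite_eulerian_subsets[OF A] by (auto simp: card_gt_0_iff)
  then have "(2::nat) ^ graph_rank G A \<le> 2 ^ card A"
    by (simp flip: card_eulerian_subsets_rank[OF A])
  then show ?thesis by simp
qed

text \<open>The eulerian subsets form the cycle space over GF(2); the exponent is its
  dimension.\<close>

lemma card_eulerian_subsets:
  assumes A: "A \<subseteq> edges G"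
  shows "card (eulerian_subsets G A) = 2 ^ (card A - graph_rank G A)"
proof -
  have "card (eulerian_subsets G A) * 2 ^ graph_rank G A
      = 2 ^ (card A - graph_rank G A) * 2 ^ graph_rank G A"
    using rank_le_card[OF A] by (simp add: card_eulerian_subsets_rank[OF A] flip: power_add)
  then show ?thesis by simp
qed

lemma rank_mono: "A \<subseteq> B \<Longrightarrow> B \<subseteq> edges G \<Longrightarrow> graph_rank G A \<le> graph_rank G B"
  unfolding graph_rank_def using num_components_antimono by (simp add: diff_le_mono2)

end

section \<open>Pairs of eulerian sets and the Tutte polynomial\<close>

text \<open>An element outside \<open>U\<close> has weight -1 inside \<open>A\<close> and 2 outside
  it, in total 1; only the signs of \<open>U\<close> survive. Read backwards, this replaces the sign
  of a union by a sum over the sets \<open>A\<close> that contain it.\<close>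

lemma sum_supersets_sign:
  assumes "finite E" "U \<subseteq> E"
  shows "(\<Sum>A | A \<subseteq> E \<and> U \<subseteq> A. (-1::real) ^ card A * 2 ^ card (E - A)) = (-1) ^ card U"
proof -
  have fin: "finite (E - U)" using assms by simp
  have "(\<Sum>A | A \<subseteq> E \<and> U \<subseteq> A. (-1::real) ^ card A * 2 ^ card (E - A))
      = (\<Sum>X\<in>Pow (E - U). (-1) ^ card U * ((-1) ^ card X * 2 ^ card (E - U - X)))"
  proof (rule sum.reindex_bij_witness[where i="\<lambda>X. X \<union> U" and j="\<lambda>A. A - U"])
    fix A assume "A \<in> {A. A \<subseteq> E \<and> U \<subseteq> A}"
    then have A: "A \<subseteq> E" "U \<subseteq> A" by auto
    then have "card A = card U + card (A - U)"
      by (metis assms(1) card_Diff_subset card_mono finite_subset le_add_diff_inverse)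
    moreover have "E - U - (A - U) = E - A" using A by auto
    ultimately show "(-1) ^ card U * ((-1) ^ card (A - U) * 2 ^ card (E - U - (A - U)))
        = (-1::real) ^ card A * 2 ^ card (E - A)"
      by (simp add: power_add)
  qed (use assms in auto)
  also have "\<dots> = (-1) ^ card U * (\<Prod>x\<in>E - U. -1 + 2)"
    unfolding prod_add[OF fin] by (simp add: sum_distrib_left)
  finally show ?thesis by simp
qed

text \<open>Exchange the sum over \<open>A\<close> defining \<open>T(-1, -1)\<close> with the sum over pairs of eulerian subsets
  of \<open>A\<close>, whose number is \<open>4\<close> to the power of the nullity of \<open>A\<close>.\<close>

lemma (in finite_multigraph) sum_eulerian_pairs_eq_tutte:
  "(\<Sum>X\<in>eulerian_subsets G (edges G). \<Sum>Y\<in>eulerian_subsets G (edges G). (-1) ^ card (X \<union> Y))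
     = 2 ^ graph_nullity G * (-1) ^ graph_rank G (edges G) * tutte G (-1) (-1)"
proof -
  let ?E = "edges G"
  let ?Z = "eulerian_subsets G ?E"
  let ?t = "\<lambda>A. (-1::real) ^ card A * 2 ^ card (?E - A)"
  note finZ = finite_eulerian_subsets[OF subset_refl]
  \<comment> \<open>As an indicator, \<open>X \<union> Y \<subseteq> A\<close> splits into a factor
    for \<open>X\<close> and a factor for \<open>Y\<close>; for fixed \<open>A\<close> the double
    sum becomes a square.\<close>
  have "(\<Sum>X\<in>?Z. \<Sum>Y\<in>?Z. (-1::real) ^ card (X \<union> Y))
      = (\<Sum>X\<in>?Z. \<Sum>Y\<in>?Z. \<Sum>A\<in>Pow ?E. of_bool (X \<union> Y \<subseteq> A) * ?t A)"
  proof (intro sum.cong refl)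
    fix X Y assume "X \<in> ?Z" "Y \<in> ?Z"
    then have "X \<union> Y \<subseteq> ?E" by (auto simp: eulerian_subsets_def)
    then have "(-1::real) ^ card (X \<union> Y) = (\<Sum>A | A \<subseteq> ?E \<and> X \<union> Y \<subseteq> A. ?t A)"
      by (intro sum_supersets_sign[symmetric] finite_edges)
    also have "\<dots> = (\<Sum>A\<in>Pow ?E. of_bool (X \<union> Y \<subseteq> A) * ?t A)"
      by (rule sum.mono_neutral_cong_left) (auto simp: finite_edges)
    finally show "(-1::real) ^ card (X \<union> Y) = \<dots>" .
  qed
  also have "\<dots> = (\<Sum>X\<in>?Z. \<Sum>A\<in>Pow ?E. \<Sum>Y\<in>?Z. of_bool (X \<union> Y \<subseteq> A) * ?t A)"
    by (intro sum.cong refl sum.swap)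
  also have "\<dots> = (\<Sum>A\<in>Pow ?E. \<Sum>X\<in>?Z. \<Sum>Y\<in>?Z. of_bool (X \<union> Y \<subseteq> A) * ?t A)"
    by (rule sum.swap)
  also have "\<dots> = (\<Sum>A\<in>Pow ?E. 2 ^ graph_nullity G * (-1) ^ graph_rank G ?E *
      ((-2) ^ (graph_rank G ?E - graph_rank G A) * (-2) ^ (card A - graph_rank G A)))"
  proof (intro sum.cong refl)
    fix A assume "A \<in> Pow ?E"
    then have A: "A \<subseteq> ?E" by simp
    have "(\<Sum>X\<in>?Z. of_bool (X \<subseteq> A) :: real) = real (card (eulerian_subsets G A))"
    proof -
      have "?Z \<inter> {X. X \<subseteq> A} = eulerian_subsets G A"
        using A by (auto simp: eulerian_subsets_def)
      then show ?thesis using finZ by simp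
    qed
    then have z: "(\<Sum>X\<in>?Z. of_bool (X \<subseteq> A) :: real) = 2 ^ (card A - graph_rank G A)"
      by (simp add: card_eulerian_subsets[OF A])
    have "(\<Sum>X\<in>?Z. \<Sum>Y\<in>?Z. of_bool (X \<union> Y \<subseteq> A) * ?t A)
        = (\<Sum>X\<in>?Z. of_bool (X \<subseteq> A)) * (\<Sum>Y\<in>?Z. of_bool (Y \<subseteq> A)) * ?t A"
      unfolding sum_product sum_distrib_right
      by (intro sum.cong refl) (simp add: of_bool_conj sum_distrib_right)
    also have "\<dots> = 2 ^ (card A - graph_rank G A) * 2 ^ (card A - graph_rank G A) * ?t A"
      by (simp only: z)
    also have "\<dots> = 2 ^ graph_nullity G * (-1) ^ graph_rank G ?E *
      ((-2) ^ (graph_rank G ?E - graph_rank G A) * (-2) ^ (card A - graph_rank G A))"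
    proof -
      \<comment> \<open>Additive names remove the truncated differences: \<open>a\<close> is the
        nullity of \<open>A\<close>, \<open>b\<close> its rank deficit and \<open>c\<close> the
        nullity of \<open>G\<close>. The powers of 2 agree since
        \<open>a + card (?E - A) = b + c\<close>; the signs agree since \<open>b\<close> enters
        twice on the right.\<close>
      obtain a where a: "card A = graph_rank G A + a"
        using rank_le_card[OF A] le_Suc_ex by blast
      obtain b where b: "graph_rank G ?E = graph_rank G A + b"
        using rank_mono[OF A subset_refl] le_Suc_ex by blast
      obtain c where c: "card ?E = graph_rank G ?E + c"
        using rank_le_card[OF subset_refl] le_Suc_ex by blast
      have d: "card ?E = card A + card (?E - A)"
        using A card_mono[OF finite_edges A] finite_edge_subset[OF A] by (simp add: card_Diff_subset)
      have "a + card (?E - A) = b + c" using a b c d by simp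
      then have e: "(2::real) ^ a * 2 ^ card (?E - A) = 2 ^ b * 2 ^ c"
        by (metis power_add)
      have "graph_nullity G = c" using c by (simp add: graph_nullity_def)
      moreover have "(-2::real) ^ k = (-1) ^ k * 2 ^ k" for k
        by (metis mult_minus1 power_mult_distrib)
      ultimately show ?thesis
        using e unfolding a b by (simp add: power_add ac_simps)
    qed
    finally show "(\<Sum>X\<in>?Z. \<Sum>Y\<in>?Z. of_bool (X \<union> Y \<subseteq> A) * ?t A) = \<dots>" .
  qed
  also have "\<dots> = 2 ^ graph_nullity G * (-1) ^ graph_rank G ?E * tutte G (-1) (-1)"
    by (simp add: tutte_def sum_distrib_left)
  finally show ?thesis .
qed

section \<open>Sums of powers of \<i> over symmetric differences\<close>

text \<open>The first product collects \<open>B - X\<close>, the second \<open>X - B\<close>.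
  Separate products over \<open>B\<close> and \<open>E - B\<close> are the shape of a term in the
  expansion of a product of sums.\<close>

lemma power_i_card_sym_diff:
  assumes "finite E" "B \<subseteq> E" "X \<subseteq> E"
  shows "\<i> ^ card (sym_diff B X)
    = (\<Prod>e\<in>B. if e \<in> X then 1 else \<i>) * (\<Prod>e\<in>E - B. if e \<in> X then \<i> else 1)"
proof -
  have fB: "finite B" using assms finite_subset by blast
  have "(\<Prod>e\<in>B. if e \<in> X then 1 else \<i>) = \<i> ^ card (B - X)"
    using fB by (simp add: prod.If_cases Diff_eq Collect_neg_eq)
  moreover have "(\<Prod>e\<in>E - B. if e \<in> X then \<i> else 1) = \<i> ^ card (X - B)"
  proof -
    have "(E - B) \<inter> {e. e \<in> X} = X - B" using assms by auto
    then show ?thesis using assms by (simp add: prod.If_cases)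
  qed
  moreover have "card (sym_diff B X) = card (B - X) + card (X - B)"
    using fB assms by (intro card_Un_disjoint) (auto intro: finite_subset)
  ultimately show ?thesis by (simp add: power_add)
qed

lemma sum_power_i_sym_diff:
  assumes E: "finite E" and X: "X \<subseteq> E" and Y: "Y \<subseteq> E"
  shows "(\<Sum>B\<in>Pow E. \<i> ^ (card (sym_diff B X) + card B + card (sym_diff B Y)))
    = (1 - \<i>) ^ card E * (-1) ^ card (X \<union> Y)"
proof -
  \<comment> \<open>\<open>f e\<close> is the weight of \<open>e\<close> in all three exponents when
    \<open>e\<close> lies in \<open>B\<close>, and \<open>g e\<close> when it does not.\<close>
  define f where "f e = (if e \<in> X then 1 else \<i>) * \<i> * (if e \<in> Y then 1 else \<i>)" for e
  define g where "g e = (if e \<in> X then \<i> else 1) * (if e \<in> Y then \<i> else 1)" for e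
  have "(\<Sum>B\<in>Pow E. \<i> ^ (card (sym_diff B X) + card B + card (sym_diff B Y)))
      = (\<Sum>B\<in>Pow E. (\<Prod>e\<in>B. f e) * (\<Prod>e\<in>E - B. g e))"
    by (intro sum.cong refl)
      (simp add: power_add power_i_card_sym_diff[OF E _ X] power_i_card_sym_diff[OF E _ Y]
        f_def g_def prod.distrib)
  also have "\<dots> = (\<Prod>e\<in>E. f e + g e)" by (simp add: prod_add[OF E])
  \<comment> \<open>If \<open>e\<close> is in neither set, \<open>f e + g e\<close> is
    \<open>-\<i> + 1\<close>; in exactly one, \<open>-1 + \<i>\<close>; in both,
    \<open>\<i> - 1\<close>. Hence the sign depends only on the union.\<close>
  also have "\<dots> = (\<Prod>e\<in>E. (1 - \<i>) * (if e \<in> X \<union> Y then -1 else 1))"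
    by (intro prod.cong refl) (auto simp: f_def g_def)
  also have "\<dots> = (1 - \<i>) ^ card E * (\<Prod>e\<in>E. if e \<in> X \<union> Y then -1 else 1)"
    by (simp add: prod.distrib)
  also have "(\<Prod>e\<in>E. if e \<in> X \<union> Y then -1 else 1 :: complex) = (-1) ^ card (X \<union> Y)"
  proof -
    have "E \<inter> {e. e \<in> X \<union> Y} = X \<union> Y" using X Y by auto
    then show ?thesis using E by (simp only: prod.If_cases prod_constant) simp
  qed
  finally show ?thesis .
qed

section \<open>Biases under uniform distributions as averages of signs\<close>

lemma pair_pmf_of_set:
  assumes "finite A" "A \<noteq> {}" "finite B" "B \<noteq> {}"
  shows "pair_pmf (pmf_of_set A) (pmf_of_set B) = pmf_of_set (A \<times> B)"
proof (rule pmf_eqI)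
  fix x :: "'a \<times> 'b"
  obtain a b where "x = (a, b)" by (cases x)
  then show "pmf (pair_pmf (pmf_of_set A) (pmf_of_set B)) x = pmf (pmf_of_set (A \<times> B)) x"
    using assms by (simp add: pmf_pair pmf_of_set indicator_def card_cartesian_product)
qed

definition event_sign :: "bool \<Rightarrow> real" where
  "event_sign b = (if b then 1 else -1)"

lemma card_diff_eq_sum_sign:
  assumes "finite S"
  shows "real (card (S \<inter> {x. P x})) - real (card (S \<inter> {x. \<not> P x})) = (\<Sum>x\<in>S. event_sign (P x))"
  using assms by (simp add: event_sign_def sum.If_cases Collect_neg_eq)

lemma bias_pmf_of_set:
  assumes "finite S" "S \<noteq> {}"
  shows "bias (measure_pmf (pmf_of_set S)) P = (\<Sum>x\<in>S. event_sign (P x)) / card S"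
  using assms
  by (simp add: bias_def measure_pmf_of_set card_diff_eq_sum_sign[symmetric] diff_divide_distrib)

text \<open>The normalisation by \<open>card S\<close> cancels. If no point of \<open>S\<close>
  satisfies \<open>Q\<close>, both sides are 0 by the convention for division by zero.\<close>

lemma cond_bias_pmf_of_set:
  assumes "finite S" "S \<noteq> {}"
  shows "cond_bias (measure_pmf (pmf_of_set S)) P Q
    = (\<Sum>x\<in>S \<inter> {x. Q x}. event_sign (P x)) / card (S \<inter> {x. Q x})"
proof -
  have "card S \<noteq> 0" using assms by simp
  moreover have "S \<inter> {x. P' x \<and> Q x} = S \<inter> {x. Q x} \<inter> {x. P' x}" for P' by auto
  ultimately show ?thesis using assms
    by (simp add: cond_bias_def cond_prob_def measure_pmf_of_set
        card_diff_eq_sum_sign[symmetric] diff_divide_distrib)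
qed

lemma Re_of_real_times: "Re (of_real a * z) = a * Re z"
  by simp

section \<open>Fourth roots of unity and the sum over all triples\<close>

text \<open>As \<open>n\<close> runs through 0, 1, 2, 3, the product is \<open>1 - \<i>\<close>,
  \<open>1 + \<i>\<close>, \<open>-1 + \<i>\<close>, \<open>-1 - \<i>\<close>, with real parts 1, 1,
  -1, -1.\<close>

lemma event_sign_mod_4: "event_sign (n mod 4 \<in> {0, 1}) = Re ((1 - \<i>) * \<i> ^ n)"
proof -
  have "\<i> ^ n = \<i> ^ (4 * (n div 4) + n mod 4)" by (simp only: mult_div_mod_eq)
  also have "\<dots> = \<i> ^ (n mod 4)" by (simp only: power_add power_mult) simp
  finally have "\<i> ^ n = \<i> ^ (n mod 4)" .
  moreover have "n mod 4 = 0 \<or> n mod 4 = 1 \<or> n mod 4 = 2 \<or> n mod 4 = 3" by linarith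
  ultimately show ?thesis by (auto simp: event_sign_def numeral_3_eq_3)
qed

text \<open>Since \<open>(1 - \<i>) ^ 4 = -4\<close> is real and nonzero, only the exponents 1 to 4
  matter, and among these only the square is purely imaginary. The exponent \<open>n + 1\<close>
  combines \<open>n\<close> edge factors with the factor \<open>1 - \<i>\<close> of the sign
  formula.\<close>

lemma Re_one_minus_i_power_eq_0_iff: "Re ((1 - \<i>) ^ (n + 1)) = 0 \<longleftrightarrow> n mod 4 = 1"
proof -
  have sq: "(1 - \<i>) ^ 2 = -2 * \<i>" by (simp add: power2_eq_square algebra_simps)
  have three: "(1 - \<i>) ^ 3 = -2 - 2 * \<i>" by (simp add: power3_eq_cube algebra_simps)
  have "(1 - \<i>) ^ 4 = ((1 - \<i>) ^ 2) ^ 2" by (simp flip: power_mult)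
  also have "\<dots> = -4" by (simp add: sq power_mult_distrib)
  finally have four: "(1 - \<i>) ^ 4 = of_real (-4)" by simp
  have "(1 - \<i>) ^ (n + 1) = (1 - \<i>) ^ (4 * (n div 4) + (n mod 4 + 1))" by simp
  also have "\<dots> = of_real ((-4) ^ (n div 4)) * (1 - \<i>) ^ (n mod 4 + 1)"
    by (simp only: power_add power_mult four of_real_power)
  finally have "Re ((1 - \<i>) ^ (n + 1)) = (-4) ^ (n div 4) * Re ((1 - \<i>) ^ (n mod 4 + 1))"
    by (simp only: Re_of_real_times)
  moreover have "n mod 4 = 0 \<or> n mod 4 = 1 \<or> n mod 4 = 2 \<or> n mod 4 = 3" by linarith
  then have "Re ((1 - \<i>) ^ (n mod 4 + 1)) = 0 \<longleftrightarrow> n mod 4 = 1"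
    by (elim disjE) (simp_all add: three four power2_eq_square)
  ultimately show ?thesis by simp
qed

lemma sum_sign_triples:
  assumes E: "finite E"
  shows "(\<Sum>x\<in>Pow E \<times> Pow E \<times> Pow E. event_sign (size_event x))
    = (-2) ^ card E * Re ((1 - \<i>) ^ (card E + 1))"
proof -
  have one: "(\<Sum>A\<in>Pow E. \<i> ^ card A) = (1 + \<i>) ^ card E"
    using sum_Pow_prod[OF E, of "\<lambda>_. \<i>"] by (simp add: add.commute)
  have "(\<Sum>x\<in>Pow E \<times> Pow E \<times> Pow E. event_sign (size_event x))
      = Re ((1 - \<i>) * (\<Sum>(A, B, C)\<in>Pow E \<times> Pow E \<times> Pow E. \<i> ^ (card A + card B + card C)))"
    by (simp only: sum_distrib_left Re_sum size_event_def case_prod_beta event_sign_mod_4)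
  also have "(\<Sum>(A, B, C)\<in>Pow E \<times> Pow E \<times> Pow E. \<i> ^ (card A + card B + card C))
      = (\<Sum>A\<in>Pow E. \<i> ^ card A) * ((\<Sum>B\<in>Pow E. \<i> ^ card B) * (\<Sum>C\<in>Pow E. \<i> ^ card C))"
    by (simp only: sum_product sum.cartesian_product' power_add case_prod_beta mult.assoc
        fst_conv snd_conv)
      (simp add: sum_distrib_left)
  also have "\<dots> = ((1 + \<i>) * ((1 + \<i>) * (1 + \<i>))) ^ card E"
    by (simp only: one power_mult_distrib)
  \<comment> \<open>Rewriting in terms of \<open>1 - \<i>\<close> isolates the factor shared with
    the conditional sum.\<close>
  also have "(1 + \<i>) * ((1 + \<i>) * (1 + \<i>)) = -2 * (1 - \<i>)" by (simp add: algebra_simps)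
  also have "(1 - \<i>) * (-2 * (1 - \<i>)) ^ card E
      = of_real ((-2) ^ card E) * (1 - \<i>) ^ (card E + 1)"
    by (simp only: power_mult_distrib) simp
  finally show ?thesis by (simp only: Re_of_real_times)
qed

section \<open>The two biases of a random triple\<close>

context finite_multigraph
begin

text \<open>A triple is determined by \<open>B\<close> and its symmetric differences
  \<open>X\<close>, \<open>Y\<close> with the outer sets, which range freely over the eulerian sets.
  The summand is arbitrary so that the same bijection serves to add signs and to count the
  event.\<close>

lemma sum_eulerian_diffs:
  fixes h :: "'e set \<times> 'e set \<times> 'e set \<Rightarrow> 'c::comm_monoid_add"
  defines "P \<equiv> Pow (edges G)" and "Z \<equiv> eulerian_subsets G (edges G)"
  shows "(\<Sum>x\<in>(P \<times> P \<times> P) \<inter> {x. eulerian_diffs G x}. h x)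
    = (\<Sum>X\<in>Z. \<Sum>Y\<in>Z. \<Sum>B\<in>P. h (sym_diff B X, B, sym_diff B Y))"
proof -
  have "(\<Sum>x\<in>(P \<times> P \<times> P) \<inter> {x. eulerian_diffs G x}. h x)
      = (\<Sum>(X, Y, B)\<in>Z \<times> Z \<times> P. h (sym_diff B X, B, sym_diff B Y))"
  proof (rule sum.reindex_bij_witness[where
        i="\<lambda>(X, Y, B). (sym_diff B X, B, sym_diff B Y)" and
        j="\<lambda>(A, B, C). (sym_diff A B, sym_diff B C, B)"])
    have cancel: "sym_diff B (sym_diff B X) = X" "sym_diff (sym_diff B X) B = X"
      "sym_diff B (sym_diff X B) = X" "sym_diff (sym_diff X B) B = X" for B X :: "'e set" by auto
    show "(case case x of (A, B, C) \<Rightarrow> (sym_diff A B, sym_diff B C, B) of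
        (X, Y, B) \<Rightarrow> (sym_diff B X, B, sym_diff B Y)) = x"
      for x :: "'e set \<times> 'e set \<times> 'e set"
      by (simp only: case_prod_beta fst_conv snd_conv cancel prod.collapse)
    show "(case case x of (X, Y, B) \<Rightarrow> (sym_diff B X, B, sym_diff B Y) of
        (A, B, C) \<Rightarrow> (sym_diff A B, sym_diff B C, B)) = x"
      for x :: "'e set \<times> 'e set \<times> 'e set"
      by (simp only: case_prod_beta fst_conv snd_conv cancel prod.collapse)
    show "(case x of (A, B, C) \<Rightarrow> (sym_diff A B, sym_diff B C, B)) \<in> Z \<times> Z \<times> P"
      if "x \<in> (P \<times> P \<times> P) \<inter> {x. eulerian_diffs G x}" for x
      using that by (auto simp: P_def Z_def eulerian_subsets_def eulerian_diffs_def)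
    show "(case x of (X, Y, B) \<Rightarrow> (sym_diff B X, B, sym_diff B Y))
        \<in> (P \<times> P \<times> P) \<inter> {x. eulerian_diffs G x}"
      if "x \<in> Z \<times> Z \<times> P" for x
    proof -
      obtain X Y B where x: "x = (X, Y, B)" by (cases x)
      then have "eulerian_diffs G (sym_diff B X, B, sym_diff B Y)"
        using that unfolding eulerian_diffs_def case_prod_conv cancel
        by (auto simp: Z_def eulerian_subsets_def)
      then show ?thesis using that unfolding x
        by (auto simp: Z_def eulerian_subsets_def P_def)
    qed
    show "(case case x of (A, B, C) \<Rightarrow> (sym_diff A B, sym_diff B C, B) of
        (X, Y, B) \<Rightarrow> h (sym_diff B X, B, sym_diff B Y)) = h x" for x
      by (simp only: case_prod_beta fst_conv snd_conv cancel prod.collapse)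
  qed
  then show ?thesis by (simp add: sum.cartesian_product case_prod_beta)
qed

lemma sum_sign_eulerian_diffs:
  defines "P \<equiv> Pow (edges G)" and "Z \<equiv> eulerian_subsets G (edges G)"
  shows "(\<Sum>x\<in>(P \<times> P \<times> P) \<inter> {x. eulerian_diffs G x}. event_sign (size_event x))
    = Re ((1 - \<i>) ^ (card (edges G) + 1)) * (\<Sum>X\<in>Z. \<Sum>Y\<in>Z. (-1) ^ card (X \<union> Y))"
proof -
  let ?c = "(1 - \<i>) ^ (card (edges G) + 1)"
  have "(\<Sum>B\<in>P. event_sign (size_event (sym_diff B X, B, sym_diff B Y)))
      = Re ?c * (-1) ^ card (X \<union> Y)" if "X \<in> Z" "Y \<in> Z" for X Y
  proof -
    have XY: "X \<subseteq> edges G" "Y \<subseteq> edges G" using that by (auto simp: Z_def eulerian_subsets_def)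
    have "(\<Sum>B\<in>P. event_sign (size_event (sym_diff B X, B, sym_diff B Y)))
        = Re ((1 - \<i>) * (\<Sum>B\<in>P. \<i> ^ (card (sym_diff B X) + card B + card (sym_diff B Y))))"
      by (simp only: sum_distrib_left Re_sum size_event_def case_prod_conv event_sign_mod_4)
    \<comment> \<open>The sign of the union is real and can therefore leave the real part.\<close>
    also have "\<dots> = Re (of_real ((-1) ^ card (X \<union> Y)) * ?c)"
      unfolding P_def sum_power_i_sym_diff[OF finite_edges XY] by (simp only: ac_simps power_add) simp
    finally show ?thesis by (simp only: Re_of_real_times mult.commute)
  qed
  then show ?thesis
    unfolding P_def Z_def sum_eulerian_diffs by (simp add: sum_distrib_left)
qed

lemma random_triple_eq:
  "random_triple G = pmf_of_set (Pow (edges G) \<times> Pow (edges G) \<times> Pow (edges G))"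
proof -
  have "finite (Pow (edges G))" "Pow (edges G) \<noteq> {}" using finite_edges by auto
  then show ?thesis by (simp add: random_triple_def pair_pmf_of_set)
qed

lemma bias_random_triple:
  "bias (random_triple G) size_event
    = (-2) ^ card (edges G) * Re ((1 - \<i>) ^ (card (edges G) + 1)) / 8 ^ card (edges G)"
proof -
  let ?P = "Pow (edges G)"
  have fin: "finite (?P \<times> ?P \<times> ?P)" "?P \<times> ?P \<times> ?P \<noteq> {}" using finite_edges by auto
  have card: "real (card (?P \<times> ?P \<times> ?P)) = 8 ^ card (edges G)"
    by (simp add: card_cartesian_product card_Pow finite_edges flip: power_mult_distrib)
  show ?thesis
    unfolding random_triple_eq bias_pmf_of_set[OF fin] sum_sign_triples[OF finite_edges] card ..
qed

lemma cond_bias_random_triple: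
  "cond_bias (random_triple G) size_event (eulerian_diffs G)
    = Re ((1 - \<i>) ^ (card (edges G) + 1)) * (-1) ^ graph_rank G (edges G) * tutte G (-1) (-1)
        / (2 ^ graph_nullity G * 2 ^ card (edges G))"
proof -
  let ?P = "Pow (edges G)" and ?Z = "eulerian_subsets G (edges G)"
  have fin: "finite (?P \<times> ?P \<times> ?P)" "?P \<times> ?P \<times> ?P \<noteq> {}" using finite_edges by auto
  \<comment> \<open>The constant summand 1 turns the reparametrisation into a count. Of its two
    factors \<open>2 ^ graph_nullity G\<close>, one cancels against the Tutte identity.\<close>
  have "card ((?P \<times> ?P \<times> ?P) \<inter> {x. eulerian_diffs G x}) = card ?Z * (card ?Z * card ?P)"
    using sum_eulerian_diffs[of "\<lambda>_. 1::nat"] by simp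
  then have "real (card ((?P \<times> ?P \<times> ?P) \<inter> {x. eulerian_diffs G x}))
      = 2 ^ graph_nullity G * (2 ^ graph_nullity G * 2 ^ card (edges G))"
    by (simp add: card_eulerian_subsets[OF subset_refl] graph_nullity_def card_Pow finite_edges)
  then show ?thesis
    unfolding random_triple_eq cond_bias_pmf_of_set[OF fin] sum_sign_eulerian_diffs
      sum_eulerian_pairs_eq_tutte by simp
qed

end

theorem theorem2p19:
  fixes G :: "('v, 'e) multigraph"
  assumes "finite_multigraph G"
  shows "(card (edges G) mod 4 \<noteq> 1 \<longrightarrow>
            bias (random_triple G) size_event \<noteq> 0 \<and>
            cond_bias (random_triple G) size_event (eulerian_diffs G)
              / bias (random_triple G) size_event
            = 2 ^ graph_rank G (edges G) * (-1) ^ graph_nullity G * tutte G (-1) (-1)) \<and>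
         (card (edges G) mod 4 = 1 \<longrightarrow>
            bias (random_triple G) size_event = 0 \<and>
            cond_bias (random_triple G) size_event (eulerian_diffs G) = 0)"
proof -
  interpret finite_multigraph G by fact
  define m r n where mrn: "m = card (edges G)" "r = graph_rank G (edges G)" "n = graph_nullity G"
  define c where "c = Re ((1 - \<i>) ^ (m + 1))"
  define t where "t = tutte G (-1) (-1)"
  have m: "m = r + n"
    using rank_le_card[OF subset_refl] by (simp add: mrn graph_nullity_def)
  have b: "bias (random_triple G) size_event = (-2) ^ m * c / 8 ^ m"
    and cb: "cond_bias (random_triple G) size_event (eulerian_diffs G)
      = c * (-1) ^ r * t / (2 ^ n * 2 ^ m)"
    by (simp_all only: bias_random_triple cond_bias_random_triple c_def mrn t_def)
  \<comment> \<open>After cancelling \<open>c\<close>, the powers of 2 leave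
    \<open>2 ^ (m - n) = 2 ^ r\<close>, and the signs leave
    \<open>(-1) ^ (r + m) = (-1) ^ n\<close>, using \<open>m = r + n\<close>.\<close>
  have "(c * (-1) ^ r * t / (2 ^ n * 2 ^ m)) / ((-2) ^ m * c / 8 ^ m) = 2 ^ r * (-1) ^ n * t"
    if "c \<noteq> 0"
  proof -
    have "(8::real) ^ k = 2 ^ k * 2 ^ k * 2 ^ k" for k by (simp flip: power_mult_distrib)
    moreover have "(-2::real) ^ k = (-1) ^ k * 2 ^ k" for k
      by (metis mult_minus1 power_mult_distrib)
    moreover have "(-1::real) ^ k * (-1) ^ k = 1" for k by (simp flip: power_mult_distrib)
    ultimately show ?thesis
      using that by (simp add: m power_add field_simps)
  qed
  \<comment> \<open>\<open>c\<close> is a factor of both biases and the only factor of the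
    unconditional one that can vanish, so it separates the two cases.\<close>
  moreover have "c = 0 \<longleftrightarrow> m mod 4 = 1" unfolding c_def by (rule Re_one_minus_i_power_eq_0_iff)
  ultimately show ?thesis by (simp add: b cb flip: mrn t_def)
qed

end
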